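(* Let $A$ and $B$ be positive definite $n\times n$ complex matrices. Then for every unitarily invariant norm $|||\cdot|||$ on the space of $n\times n$ complex matrices, $$|||A+B+A^{\frac12}B^{\frac12}+B^{\frac12}A^{\frac12}|||\le|||A+B+A\sharp B+A\natural\natural B|||.$$
   Context: For positive definite $A,B$, the geometric mean is $A\sharp B=A^{\frac12}(A^{-\frac12}BA^{-\frac12})^{\frac12}A^{\frac12}$, and $A\natural\natural B=A^{\frac12}(B^{\frac12}A^{-1}B^{\frac12})^{\frac12}A^{\frac12}$. A norm is unitarily invariant if $|||UXV|||=|||X|||$ for all $X$ and all unitary $U,V$. *)

theory Defs
  imports "HOL-Analysis.Analysis"
begin

type_synonym 'n cmatrix = "complex ^ 'n ^ 'n"

definition conj_transpose :: "'n::finite cmatrix \<Rightarrow> 'n cmatrix" where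
  "conj_transpose X = map_matrix cnj (transpose X)"

definition hermitian :: "'n::finite cmatrix \<Rightarrow> bool" where
  "hermitian X \<longleftrightarrow> conj_transpose X = X"

definition unitary :: "'n::finite cmatrix \<Rightarrow> bool" where
  "unitary U \<longleftrightarrow> conj_transpose U ** U = mat 1 \<and> U ** conj_transpose U = mat 1"

(* The quadratic form x* X x. It is real when X is hermitian, so taking the
   real part below loses nothing. *)
definition quad_form :: "'n::finite cmatrix \<Rightarrow> complex ^ 'n \<Rightarrow> complex" where
  "quad_form X x = (\<Sum>i\<in>UNIV. cnj (x $ i) * (X *v x) $ i)"

definition pos_semidef :: "'n::finite cmatrix \<Rightarrow> bool" where
  "pos_semidef X \<longleftrightarrow> hermitian X \<and> (\<forall>x. 0 \<le> Re (quad_form X x))"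

definition pos_def :: "'n::finite cmatrix \<Rightarrow> bool" where
  "pos_def X \<longleftrightarrow> hermitian X \<and> (\<forall>x. x \<noteq> 0 \<longrightarrow> 0 < Re (quad_form X x))"

(* A positive semidefinite matrix has exactly one positive semidefinite square
   root; for other arguments the value is unspecified. *)
definition msqrt :: "'n::finite cmatrix \<Rightarrow> 'n cmatrix" where
  "msqrt X = (THE S. pos_semidef S \<and> S ** S = X)"

(* The power -1/2 is rendered as the inverse of the square root. *)
definition geometric_mean :: "'n::finite cmatrix \<Rightarrow> 'n cmatrix \<Rightarrow> 'n cmatrix"
    (infixl \<open>\<sharp>\<close> 70) where
  "A \<sharp> B = msqrt A
      ** msqrt (matrix_inv (msqrt A) ** B ** matrix_inv (msqrt A))
      ** msqrt A"

definition natural_mean :: "'n::finite cmatrix \<Rightarrow> 'n cmatrix \<Rightarrow> 'n cmatrix"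
    (infixl \<open>\<natural>\<natural>\<close> 70) where
  "A \<natural>\<natural> B = msqrt A
      ** msqrt (msqrt B ** matrix_inv A ** msqrt B)
      ** msqrt A"

(* A norm on the complex vector space of matrices, as a function. The scalar
   multiple is written with map_matrix because complex ^ 'n ^ 'n carries only a
   real scalar multiplication in the library. *)
definition matrix_norm :: "('n::finite cmatrix \<Rightarrow> real) \<Rightarrow> bool" where
  "matrix_norm N \<longleftrightarrow>
     (\<forall>X. 0 \<le> N X) \<and>
     (\<forall>X. N X = 0 \<longleftrightarrow> X = 0) \<and>
     (\<forall>c X. N (map_matrix ((*) c) X) = cmod c * N X) \<and>
     (\<forall>X Y. N (X + Y) \<le> N X + N Y)"

definition unitarily_invariant_norm :: "('n::finite cmatrix \<Rightarrow> real) \<Rightarrow> bool" where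
  "unitarily_invariant_norm N \<longleftrightarrow>
     matrix_norm N \<and>
     (\<forall>U X V. unitary U \<longrightarrow> unitary V \<longrightarrow> N (U ** X ** V) = N X)"

end

theory Submission
  imports Defs
begin

text \<open>
  Write \<open>P\<close> and \<open>Q\<close> for the square roots of \<open>A\<close> and \<open>B\<close>, and \<open>K = P\<^sup>-\<^sup>1 Q\<close>. Then
  \<open>P\<^sup>-\<^sup>1 B P\<^sup>-\<^sup>1 = K K\<^sup>*\<close> and \<open>Q A\<^sup>-\<^sup>1 Q = K\<^sup>* K\<close>, so that the two means are \<open>P |K\<^sup>*| P\<close> and
  \<open>P |K| P\<close>, where \<open>|K|\<close> is the square root of \<open>K\<^sup>* K\<close>. The matrix on the left is
  \<open>(P + Q)\<^sup>2 = P (1 + K) (1 + K)\<^sup>* P\<close>, the one on the right is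
  \<open>P (1 + K K\<^sup>* + |K\<^sup>*| + |K|) P\<close>, and their difference is
  \<open>P (|K\<^sup>*| + |K| - K - K\<^sup>*) P\<close>. With a polar decomposition \<open>K = U |K|\<close> one has
  \<open>|K\<^sup>*| = U |K| U\<^sup>*\<close>, and the bracket becomes \<open>(U - 1) |K| (U - 1)\<^sup>*\<close>, which is positive
  semidefinite. So the inequality already holds in the Loewner order
  (\<open>square_of_sum_loewner_le_means\<close>).

  It remains to see that a unitarily invariant norm is monotone in the Loewner order
  (\<open>unitarily_invariant_norm_mono\<close>). If \<open>0 < X \<le> Y\<close>, then \<open>X = C Y C\<^sup>*\<close> with
  \<open>C = X\<^sup>1\<^sup>/\<^sup>2 Y\<^sup>-\<^sup>1\<^sup>/\<^sup>2\<close>, and \<open>C\<^sup>* C = Y\<^sup>-\<^sup>1\<^sup>/\<^sup>2 X Y\<^sup>-\<^sup>1\<^sup>/\<^sup>2 \<le> 1\<close>. A contraction is the average of two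
  unitary matrices: with \<open>C = U |C|\<close>, these are \<open>U (|C| \<plusminus> i (1 - |C|\<^sup>2)\<^sup>1\<^sup>/\<^sup>2)\<close>. Hence
  multiplication by \<open>C\<close> or \<open>C\<^sup>*\<close> does not increase the norm.

  Square roots come from Brouwer's theorem rather than from a spectral decomposition. For
  \<open>0 \<le> X \<le> 1\<close>, a matrix \<open>Y\<close> is a square root of \<open>X\<close> exactly when it is a fixed point of
  \<open>Y \<mapsto> Y + (X - Y\<^sup>2) / 2\<close>, and this map preserves the compact convex set of all \<open>Y\<close> with
  \<open>0 \<le> Y \<le> 1\<close> in the bicommutant of \<open>X\<close>. Since the root
  found in this way lies in the bicommutant, every other square root of \<open>X\<close> commutes with
  it, and commuting positive semidefinite roots are equal.
\<close>

section \<open>Matrix algebra and the conjugate transpose\<close>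

lemma matrix_add_rdistrib: "(A + B) ** C = A ** C + B ** (C :: 'a::semiring_1^'n^'m)"
  by (vector matrix_matrix_mult_def sum.distrib distrib_right)

lemma matrix_diff_ldistrib: "A ** (B - C) = A ** B - A ** (C :: 'a::ring_1^'n^'m)"
  by (vector matrix_matrix_mult_def sum_subtractf right_diff_distrib)

lemma matrix_diff_rdistrib: "(A - B) ** C = A ** C - B ** (C :: 'a::ring_1^'n^'m)"
  by (vector matrix_matrix_mult_def sum_subtractf left_diff_distrib)

lemma matrix_scaleR_left: "(r *\<^sub>R A) ** B = r *\<^sub>R (A ** (B :: 'a::real_algebra_1^'n^'m))"
  by (vector matrix_matrix_mult_def scaleR_sum_right)

lemma matrix_scaleR_right: "A ** (r *\<^sub>R B) = r *\<^sub>R (A ** (B :: 'a::real_algebra_1^'n^'m))"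
  by (vector matrix_matrix_mult_def scaleR_sum_right)

lemma scaleR_matrix_vector: "(r *\<^sub>R A) *v x = r *\<^sub>R (A *v (x :: 'a::real_algebra_1^'n))"
  by (vector matrix_vector_mult_def scaleR_sum_right)

lemmas matrix_ring_simps = matrix_add_ldistrib matrix_add_rdistrib matrix_diff_ldistrib
  matrix_diff_rdistrib matrix_scaleR_left matrix_scaleR_right matrix_mul_assoc

lemma matrix_inv_inverse:
  assumes "invertible A"
  shows "A ** matrix_inv A = mat 1" "matrix_inv A ** A = mat 1"
  using someI_ex[OF assms[unfolded invertible_def]] unfolding matrix_inv_def by auto

lemma map_matrix_times_eq_mat: "map_matrix ((*) c) X = mat c ** (X :: 'n::finite cmatrix)"
  by (simp add: vec_eq_iff matrix_matrix_mult_def mat_def if_distrib if_distribR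
      cong: if_cong)

lemma mat_commute: "mat c ** X = X ** mat (c::complex)" for X :: "'n::finite cmatrix"
  by (simp add: vec_eq_iff matrix_matrix_mult_def mat_def if_distrib if_distribR
      mult.commute cong: if_cong)

lemma mat_mult_mat: "mat c ** mat d = (mat (c * d) :: 'n::finite cmatrix)"
  unfolding map_matrix_times_eq_mat[symmetric] by (simp add: vec_eq_iff mat_def)

lemma conj_transpose_nth: "conj_transpose X $ i $ j = cnj (X $ j $ i)"
  by (simp add: conj_transpose_def transpose_def)

lemma conj_transpose_conj_transpose [simp]: "conj_transpose (conj_transpose X) = X"
  by (simp add: vec_eq_iff conj_transpose_nth)

lemma conj_transpose_mult:
  "conj_transpose (X ** Y) = conj_transpose Y ** conj_transpose X"
  by (simp add: vec_eq_iff conj_transpose_nth matrix_matrix_mult_def mult.commute)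

lemma conj_transpose_add: "conj_transpose (X + Y) = conj_transpose X + conj_transpose Y"
  and conj_transpose_diff: "conj_transpose (X - Y) = conj_transpose X - conj_transpose Y"
  and conj_transpose_scaleR: "conj_transpose (r *\<^sub>R X) = r *\<^sub>R conj_transpose X"
  and conj_transpose_mat: "conj_transpose (mat c) = mat (cnj c)"
  by (auto simp: vec_eq_iff conj_transpose_nth mat_def)

lemmas conj_transpose_simps = conj_transpose_mult conj_transpose_add conj_transpose_diff
  conj_transpose_scaleR conj_transpose_mat

lemma inner_mult_eq_conj_transpose:
  "x \<bullet> (X *v y) = (conj_transpose X *v x) \<bullet> (y :: complex^'n::finite)"
proof -
  have adj: "a \<bullet> (b * c) = (cnj b * a) \<bullet> c" for a b c :: complex
    by (simp add: inner_complex_def algebra_simps)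
  have "x \<bullet> (X *v y) = (\<Sum>i\<in>UNIV. \<Sum>j\<in>UNIV. (cnj (X $ i $ j) * x $ i) \<bullet> y $ j)"
    by (simp add: inner_vec_def matrix_vector_mult_def inner_sum_right adj)
  also have "\<dots> = (\<Sum>j\<in>UNIV. \<Sum>i\<in>UNIV. (cnj (X $ i $ j) * x $ i) \<bullet> y $ j)"
    by (rule sum.swap)
  also have "\<dots> = (conj_transpose X *v x) \<bullet> y"
    by (simp add: inner_vec_def matrix_vector_mult_def inner_sum_left conj_transpose_nth)
  finally show ?thesis .
qed

lemma unitary_mult:
  assumes "unitary U" "unitary V"
  shows "unitary (U ** V)"
proof -
  have "conj_transpose V ** (conj_transpose U ** U) ** V = mat 1"
    "U ** (V ** conj_transpose V) ** conj_transpose U = mat 1"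
    using assms by (simp_all add: unitary_def)
  then show ?thesis
    by (simp add: unitary_def conj_transpose_mult matrix_mul_assoc)
qed

lemma unitary_conj_transpose: "unitary U \<Longrightarrow> unitary (conj_transpose U)"
  by (simp add: unitary_def)

lemma unitaryI: "conj_transpose U ** U = mat 1 \<Longrightarrow> unitary U"
  using matrix_left_right_inverse[of U "conj_transpose U"] by (auto simp: unitary_def)

section \<open>Positive semidefinite matrices\<close>

text \<open>
  Positivity concerns only the real part of the quadratic form, so it can be handled with
  the Euclidean inner product of \<open>\<complex>\<^sup>n\<close> as a real space, for which norms and the
  Cauchy-Schwarz inequality are at hand.
\<close>

lemma Re_quad_form: "Re (quad_form X x) = x \<bullet> (X *v x)"
  by (simp add: quad_form_def inner_vec_def inner_complex_def)

lemma pos_semidef_iff: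
  "pos_semidef X \<longleftrightarrow> conj_transpose X = X \<and> (\<forall>x. 0 \<le> x \<bullet> (X *v x))"
  by (simp add: pos_semidef_def hermitian_def Re_quad_form)

lemma pos_def_iff:
  "pos_def X \<longleftrightarrow> conj_transpose X = X \<and> (\<forall>x. x \<noteq> 0 \<longrightarrow> 0 < x \<bullet> (X *v x))"
  by (simp add: pos_def_def hermitian_def Re_quad_form)

lemma pos_semidef_hermitian: "pos_semidef X \<Longrightarrow> conj_transpose X = X"
  by (simp add: pos_semidef_iff)

lemma pos_def_imp_pos_semidef:
  assumes "pos_def X"
  shows "pos_semidef X"
  unfolding pos_semidef_iff
proof (intro conjI allI)
  show "conj_transpose X = X"
    using assms by (simp add: pos_def_iff)
  show "0 \<le> x \<bullet> (X *v x)" for x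
    using assms by (cases "x = 0") (auto simp: pos_def_iff intro: less_imp_le)
qed

lemma pos_semidef_add: "pos_semidef X \<Longrightarrow> pos_semidef Y \<Longrightarrow> pos_semidef (X + Y)"
  by (simp add: pos_semidef_iff conj_transpose_add matrix_vector_mult_add_rdistrib inner_add_right)

lemma pos_semidef_scaleR: "pos_semidef X \<Longrightarrow> 0 \<le> r \<Longrightarrow> pos_semidef (r *\<^sub>R X)"
  by (simp add: pos_semidef_iff conj_transpose_scaleR scaleR_matrix_vector)

lemma pos_def_add_pos_semidef: "pos_def X \<Longrightarrow> pos_semidef Y \<Longrightarrow> pos_def (X + Y)"
  by (simp add: pos_semidef_iff pos_def_iff conj_transpose_add matrix_vector_mult_add_rdistrib
      inner_add_right add_pos_nonneg)

lemma pos_semidef_mat_1: "pos_semidef (mat 1)"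
  by (simp add: pos_semidef_iff conj_transpose_mat)

lemma inner_congruence:
  "x \<bullet> ((conj_transpose C ** X ** C) *v x) = (C *v x) \<bullet> (X *v (C *v x))"
proof -
  have "(conj_transpose C ** X ** C) *v x = conj_transpose C *v (X *v (C *v x))"
    by (simp add: matrix_vector_mul_assoc matrix_mul_assoc)
  then show ?thesis
    by (simp add: inner_mult_eq_conj_transpose[of x "conj_transpose C"])
qed

lemma pos_semidef_congruence:
  "pos_semidef X \<Longrightarrow> pos_semidef (conj_transpose C ** X ** C)"
  unfolding pos_semidef_iff inner_congruence by (simp add: conj_transpose_mult matrix_mul_assoc)

lemma pos_semidef_congruence': "pos_semidef X \<Longrightarrow> pos_semidef (C ** X ** conj_transpose C)"
  using pos_semidef_congruence[of X "conj_transpose C"] by simp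

lemma pos_semidef_gram: "pos_semidef (conj_transpose C ** C)"
  using pos_semidef_congruence[OF pos_semidef_mat_1, of C] by simp

lemma pos_semidef_square: "pos_semidef S \<Longrightarrow> pos_semidef (S ** S)"
  using pos_semidef_gram[of S] by (simp add: pos_semidef_hermitian)

lemma invertible_iff_ker:
  "invertible X \<longleftrightarrow> (\<forall>x. X *v x = 0 \<longrightarrow> x = 0)" for X :: "'n::finite cmatrix"
  using invertible_left_inverse matrix_left_invertible_ker by blast

lemma pos_def_invertible: "pos_def X \<Longrightarrow> invertible X"
  unfolding invertible_iff_ker pos_def_iff by (metis inner_zero_right less_irrefl)

lemma pos_def_gram:
  assumes "invertible C"
  shows "pos_def (conj_transpose C ** C)"
  unfolding pos_def_iff
proof (intro conjI allI impI)
  show "conj_transpose (conj_transpose C ** C) = conj_transpose C ** C"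
    by (simp add: conj_transpose_mult)
  fix x :: "complex^'a" assume "x \<noteq> 0"
  then show "0 < x \<bullet> (conj_transpose C ** C *v x)"
    using assms inner_congruence[of x C "mat 1"] by (auto simp: invertible_iff_ker)
qed

section \<open>Square roots of positive semidefinite matrices\<close>

lemma continuous_on_matrix_mult:
  fixes f g :: "'a::topological_space \<Rightarrow> 'n::finite cmatrix"
  assumes "continuous_on S f" "continuous_on S g"
  shows "continuous_on S (\<lambda>x. f x ** g x)"
  unfolding matrix_matrix_mult_def
  by (intro continuous_on_vec_lambda continuous_on_sum continuous_on_mult
      continuous_on_component assms)

lemma continuous_on_matrix_vector_mult:
  fixes f :: "'a::topological_space \<Rightarrow> 'n::finite cmatrix"
  assumes "continuous_on S f"
  shows "continuous_on S (\<lambda>x. f x *v v)"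
  unfolding matrix_vector_mult_def
  by (intro continuous_on_vec_lambda continuous_on_sum continuous_on_mult
      continuous_on_component continuous_on_const assms)

lemma closed_pos_semidef:
  fixes f :: "'n::finite cmatrix \<Rightarrow> 'n cmatrix"
  assumes f: "continuous_on UNIV f"
  shows "closed {Y. pos_semidef (f Y)}"
proof -
  have ct: "continuous_on UNIV (\<lambda>Y. conj_transpose (f Y))"
    unfolding conj_transpose_def map_matrix_def transpose_def
    by (simp, intro continuous_on_vec_lambda continuous_on_cnj continuous_on_component f)
  show ?thesis
    unfolding pos_semidef_iff
    by (intro closed_Collect_conj closed_Collect_eq closed_Collect_all closed_Collect_le
        continuous_on_inner continuous_on_const continuous_on_matrix_vector_mult ct f)
qed

text \<open>
  The difference \<open>Y - Y\<^sup>2\<close> is the sum of the congruences \<open>Y (1 - Y) Y\<close> and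
  \<open>(1 - Y) Y (1 - Y)\<close>.
\<close>

lemma pos_semidef_diff_square:
  assumes "pos_semidef Y" "pos_semidef (mat 1 - Y)"
  shows "pos_semidef (Y - Y ** Y)"
proof -
  have "pos_semidef (conj_transpose Y ** (mat 1 - Y) ** Y
      + conj_transpose (mat 1 - Y) ** Y ** (mat 1 - Y))"
    by (intro pos_semidef_add pos_semidef_congruence assms)
  moreover have "conj_transpose Y ** (mat 1 - Y) ** Y
      + conj_transpose (mat 1 - Y) ** Y ** (mat 1 - Y) = Y - Y ** Y"
    using assms by (simp add: pos_semidef_hermitian matrix_ring_simps)
  ultimately show ?thesis by simp
qed

lemma norm_le_of_pos_semidef_le_1:
  assumes "pos_semidef Y" "pos_semidef (mat 1 - Y)"
  shows "norm (Y *v x) \<le> norm x"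
proof -
  have "(Y *v x) \<bullet> (Y *v x) = x \<bullet> ((Y ** Y) *v x)"
    using inner_congruence[of x Y "mat 1"] assms(1) by (simp add: pos_semidef_hermitian)
  also have "\<dots> \<le> x \<bullet> (Y *v x)"
    using pos_semidef_diff_square[OF assms]
    by (simp add: pos_semidef_iff matrix_vector_mult_diff_rdistrib inner_diff_right)
  also have "\<dots> \<le> x \<bullet> x"
    using assms(2) by (simp add: pos_semidef_iff matrix_vector_mult_diff_rdistrib inner_diff_right)
  finally show ?thesis
    by (simp add: norm_eq_sqrt_inner)
qed

lemma bounded_unit_interval: "bounded {Y. pos_semidef Y \<and> pos_semidef (mat 1 - Y)}"
  unfolding bounded_iff
proof (intro exI ballI)
  fix Y :: "'a cmatrix" assume Y: "Y \<in> {Y. pos_semidef Y \<and> pos_semidef (mat 1 - Y)}"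
  have entry: "norm (Y $ i $ j) \<le> 1" for i j
  proof -
    have "Y $ i $ j = (Y *v axis j 1) $ i"
      by (simp add: matrix_vector_mult_def axis_def if_distrib cong: if_cong)
    also have "norm \<dots> \<le> norm (Y *v axis j 1)"
      by (rule Finite_Cartesian_Product.norm_nth_le)
    also have "\<dots> \<le> norm (axis j (1::complex))"
      using Y by (intro norm_le_of_pos_semidef_le_1) auto
    finally show ?thesis by (simp add: norm_axis_1)
  qed
  have "norm Y \<le> (\<Sum>i\<in>UNIV. norm (Y $ i))"
    by (simp add: norm_vec_def L2_set_le_sum)
  also have "\<dots> \<le> (\<Sum>i\<in>UNIV. \<Sum>j\<in>UNIV. norm (Y $ i $ j))"
    by (intro sum_mono) (simp add: norm_vec_def L2_set_le_sum)
  also have "\<dots> \<le> (\<Sum>i\<in>(UNIV::'a set). \<Sum>j\<in>(UNIV::'a set). 1)"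
    by (intro sum_mono entry)
  finally show "norm Y \<le> (\<Sum>i\<in>(UNIV::'a set). \<Sum>j\<in>(UNIV::'a set). 1)" .
qed

text \<open>
  The map \<open>F Y = Y + (X - Y\<^sup>2) / 2\<close> preserves the interval \<open>0 \<le> Y \<le> 1\<close> because
  \<open>F Y = (Y + (Y - Y\<^sup>2) + X) / 2\<close> and \<open>1 - F Y = ((1 - Y)\<^sup>2 + (1 - X)) / 2\<close>. It
  also preserves the bicommutant of \<open>X\<close>, a closed linear subspace, so Brouwer's theorem
  gives a fixed point in the intersection, and at a fixed point \<open>X = Y\<^sup>2\<close>.
\<close>

lemma sqrt_exists_unit_interval:
  fixes X :: "'n::finite cmatrix"
  assumes X: "pos_semidef X" "pos_semidef (mat 1 - X)"
  obtains S where "pos_semidef S" "S ** S = X" "\<And>Z. Z ** X = X ** Z \<Longrightarrow> Z ** S = S ** Z"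
proof -
  define I where "I = {Y :: 'n cmatrix. pos_semidef Y \<and> pos_semidef (mat 1 - Y)}"
  define W where "W = {Y. \<forall>Z. Z ** X = X ** Z \<longrightarrow> Z ** Y = Y ** Z}"
  define F where "F = (\<lambda>Y. Y + (1/2) *\<^sub>R (X - Y ** Y))"
  have "closed I"
    unfolding I_def
    by (intro closed_Collect_conj closed_pos_semidef continuous_on_diff continuous_on_const
        continuous_on_id)
  moreover have "closed W"
    unfolding W_def
    by (intro closed_Collect_all closed_Collect_imp closed_Collect_eq continuous_on_matrix_mult
        continuous_on_const continuous_on_id open_Collect_const)
  moreover have "bounded I"
    unfolding I_def by (rule bounded_unit_interval)
  ultimately have "compact (I \<inter> W)"
    by (intro compact_Int_closed) (simp_all add: compact_eq_bounded_closed)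
  moreover have "convex (I \<inter> W)"
  proof (rule convexI)
    fix Y Y' and u v :: real
    assume Y: "Y \<in> I \<inter> W" "Y' \<in> I \<inter> W" and uv: "0 \<le> u" "0 \<le> v" "u + v = 1"
    have "pos_semidef (u *\<^sub>R (mat 1 - Y) + v *\<^sub>R (mat 1 - Y'))"
      using Y uv by (intro pos_semidef_add pos_semidef_scaleR) (auto simp: I_def)
    moreover have "u *\<^sub>R (mat 1 - Y) + v *\<^sub>R (mat 1 - Y')
        = (u + v) *\<^sub>R mat 1 - (u *\<^sub>R Y + v *\<^sub>R Y')"
      by (simp add: algebra_simps)
    ultimately have "pos_semidef (mat 1 - (u *\<^sub>R Y + v *\<^sub>R Y'))"
      using uv by simp
    moreover have "pos_semidef (u *\<^sub>R Y + v *\<^sub>R Y')"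
      using Y uv by (intro pos_semidef_add pos_semidef_scaleR) (auto simp: I_def)
    ultimately show "u *\<^sub>R Y + v *\<^sub>R Y' \<in> I \<inter> W"
      using Y by (auto simp: I_def W_def matrix_ring_simps)
  qed
  moreover have "X \<in> I \<inter> W"
    using X by (auto simp: I_def W_def)
  moreover have "continuous_on (I \<inter> W) F"
    unfolding F_def
    by (intro continuous_on_add continuous_on_scaleR continuous_on_diff
        continuous_on_matrix_mult continuous_on_const continuous_on_id)
  moreover have "F \<in> I \<inter> W \<rightarrow> I \<inter> W"
  proof
    fix Y assume "Y \<in> I \<inter> W"
    then have Y: "pos_semidef Y" "pos_semidef (mat 1 - Y)"
      and comm: "\<And>Z. Z ** X = X ** Z \<Longrightarrow> Z ** Y = Y ** Z"
      by (auto simp: I_def W_def)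
    have "pos_semidef ((1/2) *\<^sub>R (Y + (Y - Y ** Y) + X))"
      by (intro pos_semidef_scaleR pos_semidef_add pos_semidef_diff_square Y X) simp
    moreover have "(1/2) *\<^sub>R (Y + (Y - Y ** Y) + X) = F Y"
      by (simp add: F_def vec_eq_iff complex_eq_iff algebra_simps)
    moreover have "pos_semidef ((1/2) *\<^sub>R ((mat 1 - Y) ** (mat 1 - Y) + (mat 1 - X)))"
      by (intro pos_semidef_scaleR pos_semidef_add pos_semidef_square Y X) simp
    moreover have "(1/2) *\<^sub>R ((mat 1 - Y) ** (mat 1 - Y) + (mat 1 - X)) = mat 1 - F Y"
      by (simp add: F_def matrix_ring_simps)
        (simp add: vec_eq_iff complex_eq_iff algebra_simps)
    moreover have "Z ** F Y = F Y ** Z" if Z: "Z ** X = X ** Z" for Z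
    proof -
      have "Z ** (Y ** Y) = Y ** Y ** Z"
        using comm[OF Z] by (metis matrix_mul_assoc)
      then show ?thesis
        using Z comm[OF Z] by (simp add: F_def matrix_ring_simps)
    qed
    ultimately show "F Y \<in> I \<inter> W"
      by (simp add: I_def W_def)
  qed
  ultimately obtain S where S: "S \<in> I \<inter> W" "F S = S"
    using brouwer[of "I \<inter> W" F] by blast
  show thesis
  proof (rule that[of S])
    show "pos_semidef S"
      using S(1) by (simp add: I_def)
    show "S ** S = X"
      using S(2) by (simp add: F_def)
    show "Z ** S = S ** Z" if "Z ** X = X ** Z" for Z
      using S(1) that unfolding W_def by blast
  qed
qed

text \<open>
  Scaling by a bound of the operator norm brings any positive semidefinite matrix into the
  unit interval.
\<close>

lemma sqrt_exists:
  fixes X :: "'n::finite cmatrix"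
  assumes X: "pos_semidef X"
  obtains S where "pos_semidef S" "S ** S = X" "\<And>Z. Z ** X = X ** Z \<Longrightarrow> Z ** S = S ** Z"
proof -
  obtain c where c: "c > 0" "\<And>x. norm (X *v x) \<le> c * norm x"
    using linear_bounded_pos[OF matrix_vector_mul_linear, of X] by (metis mult.commute)
  have "x \<bullet> (X *v x) \<le> c * (x \<bullet> x)" for x
  proof -
    have "x \<bullet> (X *v x) \<le> norm x * (c * norm x)"
      by (meson c(2) mult_left_mono norm_cauchy_schwarz norm_ge_zero order_trans)
    then show ?thesis
      by (simp add: dot_square_norm power2_eq_square ac_simps)
  qed
  then have "x \<bullet> (((1/c) *\<^sub>R X) *v x) \<le> x \<bullet> x" for x
    using c(1) by (simp add: scaleR_matrix_vector field_simps)
  then have "pos_semidef (mat 1 - (1/c) *\<^sub>R X)"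
    using X by (simp add: pos_semidef_iff conj_transpose_simps matrix_vector_mult_diff_rdistrib
        inner_diff_right)
  moreover have "pos_semidef ((1/c) *\<^sub>R X)"
    using X c(1) by (intro pos_semidef_scaleR) auto
  ultimately obtain S where S: "pos_semidef S" "S ** S = (1/c) *\<^sub>R X"
    "\<And>Z. Z ** ((1/c) *\<^sub>R X) = ((1/c) *\<^sub>R X) ** Z \<Longrightarrow> Z ** S = S ** Z"
    using sqrt_exists_unit_interval by blast
  show thesis
  proof (rule that[of "sqrt c *\<^sub>R S"])
    show "pos_semidef (sqrt c *\<^sub>R S)"
      using S(1) c(1) by (intro pos_semidef_scaleR) auto
    show "(sqrt c *\<^sub>R S) ** (sqrt c *\<^sub>R S) = X"
      using S(2) c(1) by (simp add: matrix_ring_simps)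
    show "Z ** (sqrt c *\<^sub>R S) = (sqrt c *\<^sub>R S) ** Z" if "Z ** X = X ** Z" for Z
      using S(3)[of Z] that by (simp add: matrix_ring_simps)
  qed
qed

text \<open>
  With a square root \<open>S\<close> of \<open>X\<close>, the quadratic form at \<open>x\<close> is \<open>\<parallel>S x\<parallel>\<^sup>2\<close>.
\<close>

lemma pos_semidef_ker:
  assumes "pos_semidef X" "x \<bullet> (X *v x) = 0"
  shows "X *v x = 0"
proof -
  obtain S where S: "pos_semidef S" "S ** S = X"
    using sqrt_exists[OF assms(1)] by blast
  then have "(S *v x) \<bullet> (S *v x) = 0"
    using inner_congruence[of x S "mat 1"] assms(2) by (simp add: pos_semidef_hermitian)
  then have "S *v x = 0"
    by simp
  then show ?thesis
    using S(2) by (metis matrix_vector_mul_assoc matrix_vector_mult_0_right)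
qed

text \<open>
  With \<open>D = S - T\<close>, commutativity gives \<open>D S D + D T D = D (S\<^sup>2 - T\<^sup>2) = 0\<close>. Both summands are
  positive semidefinite, so \<open>S\<close> and \<open>T\<close> both vanish on the range of \<open>D\<close>. Hence
  \<open>D\<^sup>2 = 0\<close>, and \<open>D = 0\<close> because \<open>D\<close> is hermitian.
\<close>

lemma commuting_sqrt_unique:
  assumes S: "pos_semidef S" and T: "pos_semidef T"
    and sq: "S ** S = T ** T" and comm: "S ** T = T ** S"
  shows "S = T"
proof -
  define D where "D = S - T"
  have D: "conj_transpose D = D"
    using S T by (simp add: D_def conj_transpose_diff pos_semidef_hermitian)
  have "(S + T) ** D = 0"
    using sq comm by (simp add: D_def matrix_ring_simps)
  then have *: "(S + T) *v (D *v x) = 0" for x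
    by (simp add: matrix_vector_mul_assoc)
  have "D *v x = 0" for x
  proof -
    define y where "y = D *v x"
    have "y \<bullet> (S *v y) + y \<bullet> (T *v y) = 0"
      using *[of x] by (simp add: y_def inner_add_right[symmetric]
          matrix_vector_mult_add_rdistrib[symmetric])
    moreover have "0 \<le> y \<bullet> (S *v y)" "0 \<le> y \<bullet> (T *v y)"
      using S T by (auto simp: pos_semidef_iff)
    ultimately have "S *v y = 0" "T *v y = 0"
      using S T by (auto intro!: pos_semidef_ker)
    then have "D *v y = 0"
      by (simp add: D_def matrix_vector_mult_diff_rdistrib)
    then have "x \<bullet> (D *v y) = 0"
      by simp
    then have "y \<bullet> y = 0"
      by (simp add: inner_mult_eq_conj_transpose D flip: y_def)
    then show ?thesis
      by (simp add: y_def)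
  qed
  then show ?thesis
    by (simp add: D_def matrix_eq matrix_vector_mult_diff_rdistrib)
qed

text \<open>
  Any square root \<open>T\<close> of \<open>X\<close> commutes with \<open>X\<close>, hence with the root in the bicommutant
  of \<open>X\<close>, and so it coincides with it.
\<close>

lemma sqrt_exists_unique:
  assumes "pos_semidef X"
  shows "\<exists>!S. pos_semidef S \<and> S ** S = X"
proof -
  obtain R where R: "pos_semidef R" "R ** R = X" "\<And>Z. Z ** X = X ** Z \<Longrightarrow> Z ** R = R ** Z"
    using sqrt_exists[OF assms] by blast
  have "T = R" if T: "pos_semidef T" "T ** T = X" for T
  proof (rule commuting_sqrt_unique)
    show "T ** R = R ** T"
      using R(3)[of T] T(2) by (metis matrix_mul_assoc)
  qed (simp_all add: R(1,2) T)
  with R(1,2) show ?thesis by blast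
qed

lemma pos_semidef_msqrt: "pos_semidef X \<Longrightarrow> pos_semidef (msqrt X)"
  and msqrt_square: "pos_semidef X \<Longrightarrow> msqrt X ** msqrt X = X"
  using theI'[OF sqrt_exists_unique[of X]] by (auto simp: msqrt_def)

lemma msqrt_eqI:
  assumes "pos_semidef S" "S ** S = X"
  shows "msqrt X = S"
  unfolding msqrt_def
  using assms pos_semidef_square[of S] by (intro the1_equality sqrt_exists_unique) simp_all

lemma msqrt_commute:
  assumes "pos_semidef X" "Z ** X = X ** Z"
  shows "Z ** msqrt X = msqrt X ** Z"
proof -
  obtain R where R: "pos_semidef R" "R ** R = X" "\<And>Y. Y ** X = X ** Y \<Longrightarrow> Y ** R = R ** Y"
    using sqrt_exists[OF assms(1)] by blast
  have "msqrt X = R"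
    using R(1,2) by (rule msqrt_eqI)
  then show ?thesis
    using R(3)[OF assms(2)] by simp
qed

lemma pos_def_msqrt:
  assumes X: "pos_def X"
  shows "pos_def (msqrt X)"
  unfolding pos_def_iff
proof (intro conjI allI impI)
  have S: "pos_semidef (msqrt X)" "msqrt X ** msqrt X = X"
    using X by (auto intro: pos_def_imp_pos_semidef pos_semidef_msqrt msqrt_square)
  then show "conj_transpose (msqrt X) = msqrt X"
    by (simp add: pos_semidef_hermitian)
  fix x :: "complex^'a" assume "x \<noteq> 0"
  then have "X *v x \<noteq> 0"
    using X by (auto simp: pos_def_iff)
  then have "msqrt X *v x \<noteq> 0"
    using S(2) by (metis matrix_vector_mul_assoc matrix_vector_mult_0_right)
  then have "x \<bullet> (msqrt X *v x) \<noteq> 0"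
    using pos_semidef_ker[OF S(1)] by blast
  then show "0 < x \<bullet> (msqrt X *v x)"
    using S(1) by (simp add: pos_semidef_iff order_less_le)
qed

section \<open>Polar decomposition and contractions\<close>

text \<open>
  The unitary factor is \<open>K |K|\<^sup>-\<^sup>1\<close>; in the proof \<open>H = |K|\<close> and \<open>G = H\<^sup>-\<^sup>1\<close>.
\<close>

lemma polar_decomposition:
  assumes "invertible K"
  obtains U where "unitary U" "K = U ** msqrt (conj_transpose K ** K)"
proof -
  define H where "H = msqrt (conj_transpose K ** K)"
  have K: "pos_def (conj_transpose K ** K)"
    using assms by (rule pos_def_gram)
  then have H: "pos_def H" "H ** H = conj_transpose K ** K" "conj_transpose H = H"
    by (auto simp: H_def intro: pos_def_msqrt msqrt_square pos_def_imp_pos_semidef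
        pos_semidef_hermitian pos_semidef_msqrt)
  define G where "G = matrix_inv H"
  have G: "H ** G = mat 1" "G ** H = mat 1"
    using matrix_inv_inverse pos_def_invertible[OF H(1)] by (auto simp: G_def)
  have "conj_transpose G ** H = conj_transpose (H ** G)"
    by (simp add: conj_transpose_mult H)
  then have G': "conj_transpose G ** H = mat 1"
    by (simp add: G conj_transpose_mat)
  have "conj_transpose (K ** G) ** (K ** G) = conj_transpose G ** (conj_transpose K ** K) ** G"
    by (simp add: conj_transpose_mult matrix_mul_assoc)
  also have "\<dots> = (conj_transpose G ** H) ** (H ** G)"
    by (simp add: H(2)[symmetric] matrix_mul_assoc)
  finally have "unitary (K ** G)"
    by (intro unitaryI) (simp add: G G')
  moreover have "K = K ** G ** H"
    by (simp add: G(2) flip: matrix_mul_assoc)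
  ultimately show thesis
    using that by (simp add: H_def)
qed

text \<open>
  For \<open>C = U H\<close> with \<open>H = |C|\<close> and \<open>G = (1 - H\<^sup>2)\<^sup>1\<^sup>/\<^sup>2\<close>, the matrix \<open>V = H + i G\<close> is unitary
  because \<open>H\<close> and \<open>G\<close> commute, and \<open>2 H = V + V\<^sup>*\<close>.
\<close>

lemma contraction_average_unitary:
  fixes C :: "'n::finite cmatrix"
  assumes "invertible C" and contr: "pos_semidef (mat 1 - conj_transpose C ** C)"
  obtains V W where "unitary V" "unitary W" "C + C = V + W"
proof -
  define H where "H = msqrt (conj_transpose C ** C)"
  define G where "G = msqrt (mat 1 - H ** H)"
  obtain U where U: "unitary U" "C = U ** H"
    using polar_decomposition[OF assms(1)] by (auto simp: H_def)
  have HH: "H ** H = conj_transpose C ** C"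
    by (simp add: H_def msqrt_square pos_semidef_gram)
  have "conj_transpose H = H"
    by (simp add: H_def pos_semidef_hermitian pos_semidef_msqrt pos_semidef_gram)
  moreover have "pos_semidef (mat 1 - H ** H)"
    using contr by (simp add: HH)
  then have "G ** G = mat 1 - H ** H" "conj_transpose G = G" "H ** G = G ** H"
    by (simp_all add: G_def msqrt_square pos_semidef_hermitian pos_semidef_msqrt)
      (rule msqrt_commute; simp add: matrix_ring_simps)
  ultimately have HG: "conj_transpose H = H" "conj_transpose G = G" "H ** G = G ** H"
    "G ** G = mat 1 - H ** H"
    by auto
  define V where "V = H + mat \<i> ** G"
  have V': "conj_transpose V = H - mat \<i> ** G"
  proof -
    have "mat (- \<i>) ** G = - (mat \<i> ** G)"
      by (simp flip: map_matrix_times_eq_mat add: vec_eq_iff)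
    then show ?thesis
      by (simp add: V_def conj_transpose_simps HG flip: mat_commute)
  qed
  have "(mat \<i> ** G) ** (mat \<i> ** G) = (mat \<i> ** mat \<i>) ** (G ** G)"
    by (metis mat_commute matrix_mul_assoc)
  also have "\<dots> = mat (- 1) ** (G ** G)"
    by (simp add: mat_mult_mat)
  also have "\<dots> = - (G ** G)"
    by (simp add: vec_eq_iff flip: map_matrix_times_eq_mat)
  finally have iG: "(mat \<i> ** G) ** (mat \<i> ** G) = - (G ** G)" .
  have HiG: "H ** (mat \<i> ** G) = (mat \<i> ** G) ** H"
    using HG(3) by (metis mat_commute matrix_mul_assoc)
  have "conj_transpose V ** V
      = H ** H + H ** (mat \<i> ** G) - (mat \<i> ** G) ** H - (mat \<i> ** G) ** (mat \<i> ** G)"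
    unfolding V' unfolding V_def
    by (simp only: matrix_add_ldistrib matrix_diff_rdistrib) (simp add: algebra_simps)
  also have "\<dots> = mat 1"
    by (simp add: HiG iG HG(4))
  finally have V: "unitary V"
    by (rule unitaryI)
  show thesis
  proof (rule that)
    show "unitary (U ** V)" "unitary (U ** conj_transpose V)"
      using U V by (auto intro: unitary_mult unitary_conj_transpose)
    have "V + conj_transpose V = H + H"
      unfolding V' unfolding V_def by simp
    then show "C + C = U ** V + U ** conj_transpose V"
      by (simp add: U(2) flip: matrix_add_ldistrib)
  qed
qed

section \<open>Monotonicity of unitarily invariant norms\<close>

lemma unitarily_invariant_norm_double:
  assumes "unitarily_invariant_norm N"
  shows "N (X + X) = 2 * N X"
proof -
  have "X + X = map_matrix ((*) 2) X"
    by (simp add: vec_eq_iff)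
  then show ?thesis
    using assms by (simp add: unitarily_invariant_norm_def matrix_norm_def)
qed

text \<open>
  Each bound is the triangle inequality for \<open>2 C = V + W\<close> with \<open>V\<close> and \<open>W\<close> unitary.
\<close>

lemma unitarily_invariant_norm_contraction:
  assumes N: "unitarily_invariant_norm N"
    and C: "invertible C" "pos_semidef (mat 1 - conj_transpose C ** C)"
  shows "N (C ** X) \<le> N X" and "N (X ** conj_transpose C) \<le> N X"
proof -
  obtain V W where VW: "unitary V" "unitary W" "C + C = V + W"
    using contraction_average_unitary[OF C] by blast
  have one: "unitary (mat 1)"
    by (simp add: unitary_def conj_transpose_mat)
  have "N (U ** Z ** U') = N Z" if "unitary U" "unitary U'" for U Z U'
    using N that by (simp add: unitarily_invariant_norm_def)
  from this[OF _ one] this[OF one]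
  have inv: "N (U ** Z) = N Z" "N (Z ** U) = N Z" if "unitary U" for U Z
    using that by simp_all
  have tri: "N (Y + Z) \<le> N Y + N Z" for Y Z
    using N by (simp add: unitarily_invariant_norm_def matrix_norm_def)
  have "C ** X + C ** X = V ** X + W ** X"
    using VW(3) by (simp flip: matrix_add_rdistrib)
  then have "2 * N (C ** X) \<le> N (V ** X) + N (W ** X)"
    by (metis tri unitarily_invariant_norm_double[OF N])
  then show "N (C ** X) \<le> N X"
    using VW by (simp add: inv)
  have "conj_transpose C + conj_transpose C = conj_transpose V + conj_transpose W"
    using VW(3) by (simp flip: conj_transpose_add)
  then have "X ** conj_transpose C + X ** conj_transpose C
      = X ** conj_transpose V + X ** conj_transpose W"
    by (simp flip: matrix_add_ldistrib)
  then have "2 * N (X ** conj_transpose C) \<le> N (X ** conj_transpose V) + N (X ** conj_transpose W)"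
    by (metis tri unitarily_invariant_norm_double[OF N])
  then show "N (X ** conj_transpose C) \<le> N X"
    using VW by (simp add: inv unitary_conj_transpose)
qed

text \<open>
  With \<open>C = X\<^sup>1\<^sup>/\<^sup>2 Y\<^sup>-\<^sup>1\<^sup>/\<^sup>2\<close> one has \<open>X = C Y C\<^sup>*\<close>, and \<open>X \<le> Y\<close> says that \<open>C\<close> is a contraction.
  Definiteness of \<open>X\<close> makes \<open>C\<close> invertible, so that its unitary polar factor is
  \<open>C |C|\<^sup>-\<^sup>1\<close>.
\<close>

lemma unitarily_invariant_norm_mono:
  assumes N: "unitarily_invariant_norm N"
    and X: "pos_def X" and le: "pos_semidef (Y - X)"
  shows "N X \<le> N Y"
proof -
  have Y: "pos_def Y"
    using pos_def_add_pos_semidef[OF X le] by simp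
  define S where "S = msqrt X"
  define T where "T = msqrt Y"
  define R where "R = matrix_inv T"
  have S: "conj_transpose S = S" "S ** S = X" "invertible S"
    using X by (auto simp: S_def intro: msqrt_square pos_semidef_hermitian pos_semidef_msqrt
        pos_def_imp_pos_semidef pos_def_msqrt pos_def_invertible)
  have T: "conj_transpose T = T" "T ** T = Y" "invertible T"
    using Y by (auto simp: T_def intro: msqrt_square pos_semidef_hermitian pos_semidef_msqrt
        pos_def_imp_pos_semidef pos_def_msqrt pos_def_invertible)
  have R: "T ** R = mat 1" "R ** T = mat 1"
    using matrix_inv_inverse[OF T(3)] by (auto simp: R_def)
  have R': "conj_transpose R ** T = mat 1" "T ** conj_transpose R = mat 1"
    using R T(1) by (metis conj_transpose_mult conj_transpose_mat complex_cnj_one)+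
  define C where "C = S ** R"
  have "C ** Y ** conj_transpose C = S ** (R ** T) ** (T ** conj_transpose R) ** S"
    by (simp add: C_def conj_transpose_mult S(1) T(2)[symmetric] matrix_mul_assoc)
  then have XC: "C ** Y ** conj_transpose C = X"
    by (simp add: R R' S(2))
  have "conj_transpose R ** Y ** R = (conj_transpose R ** T) ** (T ** R)"
    by (simp add: T(2)[symmetric] matrix_mul_assoc)
  then have "conj_transpose R ** (Y - X) ** R = mat 1 - conj_transpose C ** C"
    by (simp add: matrix_diff_ldistrib matrix_diff_rdistrib R R' C_def conj_transpose_mult S(1))
      (simp add: S(2)[symmetric] matrix_mul_assoc)
  then have contr: "pos_semidef (mat 1 - conj_transpose C ** C)"
    using pos_semidef_congruence[OF le, of R] by simp
  have inv: "invertible C"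
    unfolding C_def using S(3) R by (intro invertible_mult) (auto simp: invertible_def)
  have "N (C ** Y ** conj_transpose C) \<le> N (C ** Y)"
    by (rule unitarily_invariant_norm_contraction(2)[OF N inv contr])
  also have "\<dots> \<le> N Y"
    by (rule unitarily_invariant_norm_contraction(1)[OF N inv contr])
  finally show ?thesis
    by (simp add: XC)
qed

section \<open>The Loewner order inequality for the means\<close>

text \<open>
  If \<open>K = U H\<close> with \<open>H = |K|\<close>, then \<open>U H U\<^sup>*\<close> is positive semidefinite with square \<open>K K\<^sup>*\<close>, so
  it is \<open>|K\<^sup>*|\<close>, and the matrix in question is \<open>(U - 1) H (U - 1)\<^sup>*\<close>.
\<close>

lemma sum_adjoint_loewner_le_abs:
  assumes "invertible K"
  shows "pos_semidef (msqrt (K ** conj_transpose K) + msqrt (conj_transpose K ** K)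
    - K - conj_transpose K)"
proof -
  define H where "H = msqrt (conj_transpose K ** K)"
  obtain U where U: "unitary U" "K = U ** H"
    using polar_decomposition[OF assms] by (auto simp: H_def)
  have H: "pos_semidef H" "conj_transpose H = H"
    by (simp_all add: H_def pos_semidef_msqrt pos_semidef_gram pos_semidef_hermitian)
  have "U ** H ** conj_transpose U ** (U ** H ** conj_transpose U)
      = U ** H ** (conj_transpose U ** U) ** H ** conj_transpose U"
    by (simp add: matrix_mul_assoc)
  also have "\<dots> = K ** conj_transpose K"
    using U(1) by (simp add: U(2) conj_transpose_mult H(2) unitary_def matrix_mul_assoc)
  finally have "msqrt (K ** conj_transpose K) = U ** H ** conj_transpose U"
    by (intro msqrt_eqI pos_semidef_congruence' H)
  then have "msqrt (K ** conj_transpose K) + msqrt (conj_transpose K ** K) - K - conj_transpose K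
      = (U - mat 1) ** H ** conj_transpose (U - mat 1)"
    by (simp flip: H_def)
      (simp add: U(2) conj_transpose_simps H(2) matrix_ring_simps)
  then show ?thesis
    by (simp add: pos_semidef_congruence' H)
qed

text \<open>
  The difference is the congruence by \<open>P\<close>, the square root of \<open>A\<close>, of the matrix in the
  previous lemma, taken for \<open>K = P\<^sup>-\<^sup>1 Q\<close> with \<open>Q\<close> the square root of \<open>B\<close>.
\<close>

lemma square_of_sum_loewner_le_means:
  assumes A: "pos_def A" and B: "pos_def B"
  shows "pos_semidef ((A + B + A \<sharp> B + A \<natural>\<natural> B)
    - (A + B + msqrt A ** msqrt B + msqrt B ** msqrt A))"
proof -
  define P where "P = msqrt A"
  define Q where "Q = msqrt B"
  define R where "R = matrix_inv P"
  define K where "K = R ** Q"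
  have P: "conj_transpose P = P" "P ** P = A" "invertible P"
    using A by (auto simp: P_def intro: msqrt_square pos_semidef_hermitian pos_semidef_msqrt
        pos_def_imp_pos_semidef pos_def_msqrt pos_def_invertible)
  have Q: "conj_transpose Q = Q" "Q ** Q = B" "invertible Q"
    using B by (auto simp: Q_def intro: msqrt_square pos_semidef_hermitian pos_semidef_msqrt
        pos_def_imp_pos_semidef pos_def_msqrt pos_def_invertible)
  have R: "P ** R = mat 1" "R ** P = mat 1"
    using matrix_inv_inverse[OF P(3)] by (auto simp: R_def)
  have R': "conj_transpose R = R"
  proof -
    have "conj_transpose R ** P = mat 1"
      using R(1) P(1) by (metis conj_transpose_mult conj_transpose_mat complex_cnj_one)
    then show ?thesis
      using R(1) by (metis matrix_mul_assoc matrix_mul_lid matrix_mul_rid)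
  qed
  have A_inv: "matrix_inv A = R ** R"
  proof -
    have "A ** (R ** R) = P ** (P ** R) ** R"
      by (simp add: P(2)[symmetric] matrix_mul_assoc)
    then have "A ** (R ** R) = mat 1"
      by (simp add: R)
    moreover have "matrix_inv A ** A = mat 1"
      using matrix_inv_inverse(2)[OF pos_def_invertible[OF A]] .
    ultimately show ?thesis
      by (metis matrix_mul_assoc matrix_mul_lid matrix_mul_rid)
  qed
  have K': "conj_transpose K = Q ** R"
    by (simp add: K_def conj_transpose_mult Q R')
  have "R ** B ** R = K ** conj_transpose K"
    unfolding K' by (simp add: K_def Q(2)[symmetric] matrix_mul_assoc)
  then have geom: "A \<sharp> B = P ** msqrt (K ** conj_transpose K) ** P"
    by (simp add: geometric_mean_def flip: P_def R_def)
  have "Q ** matrix_inv A ** Q = conj_transpose K ** K"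
    unfolding K' by (simp add: K_def A_inv matrix_mul_assoc)
  then have nat: "A \<natural>\<natural> B = P ** msqrt (conj_transpose K ** K) ** P"
    by (simp add: natural_mean_def flip: P_def Q_def)
  have "invertible K"
    unfolding K_def using Q(3) R by (intro invertible_mult) (auto simp: invertible_def)
  then have "pos_semidef (conj_transpose P ** (msqrt (K ** conj_transpose K)
      + msqrt (conj_transpose K ** K) - K - conj_transpose K) ** P)"
    by (intro pos_semidef_congruence sum_adjoint_loewner_le_abs)
  moreover have "P ** K ** P = Q ** P" "P ** conj_transpose K ** P = P ** Q"
  proof -
    have "P ** K ** P = (P ** R) ** Q ** P"
      by (simp add: K_def matrix_mul_assoc)
    then show "P ** K ** P = Q ** P"
      by (simp add: R)
    have "P ** conj_transpose K ** P = P ** Q ** (R ** P)"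
      by (simp add: K' matrix_mul_assoc)
    then show "P ** conj_transpose K ** P = P ** Q"
      by (simp add: R)
  qed
  ultimately have "pos_semidef (A \<sharp> B + A \<natural>\<natural> B - Q ** P - P ** Q)"
    by (simp add: geom nat P(1) matrix_add_ldistrib matrix_add_rdistrib matrix_diff_ldistrib
        matrix_diff_rdistrib)
  moreover have "A \<sharp> B + A \<natural>\<natural> B - Q ** P - P ** Q
      = (A + B + A \<sharp> B + A \<natural>\<natural> B) - (A + B + P ** Q + Q ** P)"
    by simp
  ultimately show ?thesis
    by (simp only: P_def Q_def)
qed

lemma pos_def_square_of_sum:
  assumes A: "pos_def A" and B: "pos_def B"
  shows "pos_def (A + B + msqrt A ** msqrt B + msqrt B ** msqrt A)"
proof -
  define S where "S = msqrt A + msqrt B"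
  have S: "pos_def S"
    unfolding S_def using A B
    by (intro pos_def_add_pos_semidef pos_def_imp_pos_semidef pos_def_msqrt)
  have "S ** S = A + B + msqrt A ** msqrt B + msqrt B ** msqrt A"
    using A B by (simp add: S_def matrix_ring_simps msqrt_square pos_def_imp_pos_semidef)
  moreover have "conj_transpose S = S"
    using S by (simp add: pos_def_iff)
  ultimately show ?thesis
    using pos_def_gram[OF pos_def_invertible[OF S]] by simp
qed

theorem corollary4p1:
  fixes A B :: "'n::finite cmatrix"
    and N :: "'n cmatrix \<Rightarrow> real"
  assumes "pos_def A" and "pos_def B"
    and "unitarily_invariant_norm N"
  shows "N (A + B + msqrt A ** msqrt B + msqrt B ** msqrt A)
           \<le> N (A + B + A \<sharp> B + A \<natural>\<natural> B)"
  using assms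
  by (intro unitarily_invariant_norm_mono pos_def_square_of_sum square_of_sum_loewner_le_means)

end
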